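(* Let $M$ be a metric space, let $f\colon M\to M$ be a Lipschitz map and let $e\in M$. Then $T_{f,e}\colon\mathcal F(M,e)\to\mathcal F(M,e)$ is not a wild operator.
   Context: $\mathbb K$ denotes $\mathbb R$ or $\mathbb C$. For a metric space $M$ and $e\in M$, $\mathrm{Lip}_0(M,e)$ is the Banach space of Lipschitz functions $\varphi\colon M\to\mathbb K$ with $\varphi(e)=0$, normed by the best Lipschitz constant. For $x\in M$, $\delta(x)=\delta_e(x)\in \mathrm{Lip}_0(M,e)^*$ is the evaluation functional $\varphi\mapsto\varphi(x)$. The Lipschitz-free space with basepoint $e$ is $\mathcal F(M,e):=\overline{\mathrm{span}}\{\delta(x):x\in M\}\subset \mathrm{Lip}_0(M,e)^*$ (norm closure). For a Lipschitz map $f\colon M\to M$ (not assumed to fix $e$), $T_{f,e}\colon\mathcal F(M,e)\to\mathcal F(M,e)$ is the unique bounded linear operator with $T_{f,e}(\delta(x))=\delta(f(x))-\delta(f(e))$ for all $x\in M$. For a bounded operator $T\colon X\to X$ on a Banach space, put $R_T:=\{x\in X:\liminf_{n\to\infty}\|T^nx-x\|=0\}$ and $A_T:=\{x\in X:\lim_{n\to\infty}\|T^nx\|=\infty\}$. The operator $T$ is called wild if $X=A_T\cup R_T$ and both $R_T$ and $A_T$ have non-empty interior. *)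

theory Defs
  imports "HOL-Analysis.Analysis" "HOL-Library.Function_Algebras"
begin

section \<open>Pointwise vector space structure and bounded linear maps\<close>

definition pscale :: "'k::times \<Rightarrow> ('b \<Rightarrow> 'k) \<Rightarrow> 'b \<Rightarrow> 'k" where
  "pscale c g = (\<lambda>x. c * g x)"

interpretation pointwise: vector_space "pscale :: 'k::field \<Rightarrow> ('b \<Rightarrow> 'k) \<Rightarrow> 'b \<Rightarrow> 'k"
  by unfold_locales (auto simp: pscale_def fun_eq_iff algebra_simps)

text \<open>The normed spaces below depend on the base point, so they cannot be types: a normed space
  is a carrier set inside an ambient type, together with a scalar multiplication and a norm.\<close>

definition bounded_linear_on ::
  "('k \<Rightarrow> 'v \<Rightarrow> 'v) \<Rightarrow> 'v::plus set \<Rightarrow> ('v \<Rightarrow> real) \<Rightarrow>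
   ('k \<Rightarrow> 'w \<Rightarrow> 'w) \<Rightarrow> 'w::plus set \<Rightarrow> ('w \<Rightarrow> real) \<Rightarrow> ('v \<Rightarrow> 'w) \<Rightarrow> bool" where
  "bounded_linear_on s X N t Y N' T \<longleftrightarrow>
     T \<in> X \<rightarrow> Y \<and>
     (\<forall>u\<in>X. \<forall>v\<in>X. T (u + v) = T u + T v) \<and>
     (\<forall>c. \<forall>u\<in>X. T (s c u) = t c (T u)) \<and>
     (\<exists>C. \<forall>u\<in>X. N' (T u) \<le> C * N u)"


section \<open>The Lipschitz space, its dual and the Lipschitz-free space\<close>

definition lip0 :: "'a::metric_space \<Rightarrow> ('a \<Rightarrow> 'k::real_normed_field) set" where
  "lip0 e = {\<phi>. (\<exists>C. C-lipschitz_on UNIV \<phi>) \<and> \<phi> e = 0}"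

definition lip_norm :: "('a::metric_space \<Rightarrow> 'k::real_normed_field) \<Rightarrow> real" where
  "lip_norm \<phi> = Inf {C. C-lipschitz_on UNIV \<phi>}"

text \<open>Functionals on \<^term>\<open>lip0 e\<close> are total functions, normalised to be 0 off \<^term>\<open>lip0 e\<close>.\<close>

definition lip0_dual :: "'a::metric_space \<Rightarrow> (('a \<Rightarrow> 'k::real_normed_field) \<Rightarrow> 'k) set" where
  "lip0_dual e = {u. bounded_linear_on pscale (lip0 e) lip_norm (*) UNIV norm u \<and>
                     (\<forall>\<phi>. \<phi> \<notin> lip0 e \<longrightarrow> u \<phi> = 0)}"

text \<open>Off the dual space the supremum need not exist; the value 0 there makes the induced
  distance nonnegative and symmetric everywhere, as the locale \<^locale>\<open>Metric_space\<close> demands.\<close>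

definition dual_norm :: "'a::metric_space \<Rightarrow> (('a \<Rightarrow> 'k::real_normed_field) \<Rightarrow> 'k) \<Rightarrow> real" where
  "dual_norm e u =
     (if u \<in> lip0_dual e then SUP \<phi>\<in>{\<phi> \<in> lip0 e. lip_norm \<phi> \<le> 1}. norm (u \<phi>) else 0)"

definition delta :: "'a::metric_space \<Rightarrow> 'a \<Rightarrow> ('a \<Rightarrow> 'k::real_normed_field) \<Rightarrow> 'k" where
  "delta e x = (\<lambda>\<phi>. if \<phi> \<in> lip0 e then \<phi> x else 0)"

definition lip_free :: "'a::metric_space \<Rightarrow> (('a \<Rightarrow> 'k::real_normed_field) \<Rightarrow> 'k) set" where
  "lip_free e =
     Metric_space.mtopology (lip0_dual e) (\<lambda>u v. dual_norm e (u - v))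
       closure_of pointwise.span (range (delta e))"

text \<open>As a map on the carrier \<^term>\<open>lip_free e\<close> the operator is extensional, i.e. \<^term>\<open>undefined\<close>
  elsewhere; this makes it unique as a total function.\<close>

definition is_lip_free_map ::
  "('a::metric_space \<Rightarrow> 'a) \<Rightarrow> 'a \<Rightarrow>
   ((('a \<Rightarrow> 'k::real_normed_field) \<Rightarrow> 'k) \<Rightarrow> (('a \<Rightarrow> 'k) \<Rightarrow> 'k)) \<Rightarrow> bool" where
  "is_lip_free_map f e T \<longleftrightarrow>
     T \<in> extensional (lip_free e) \<and>
     bounded_linear_on pscale (lip_free e) (dual_norm e) pscale (lip_free e) (dual_norm e) T \<and>
     (\<forall>x. T (delta e x) = delta e (f x) - delta e (f e))"

definition lip_free_map ::
  "('a::metric_space \<Rightarrow> 'a) \<Rightarrow> 'a \<Rightarrow>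
   (('a \<Rightarrow> 'k::real_normed_field) \<Rightarrow> 'k) \<Rightarrow> (('a \<Rightarrow> 'k) \<Rightarrow> 'k)" where
  "lip_free_map f e = (THE T. is_lip_free_map f e T)"


section \<open>Wild operators\<close>

definition recurrent_set :: "'v::ab_group_add set \<Rightarrow> ('v \<Rightarrow> real) \<Rightarrow> ('v \<Rightarrow> 'v) \<Rightarrow> 'v set" where
  "recurrent_set X N T = {x \<in> X. liminf (\<lambda>n. ereal (N ((T ^^ n) x - x))) = 0}"

definition escaping_set :: "'v::ab_group_add set \<Rightarrow> ('v \<Rightarrow> real) \<Rightarrow> ('v \<Rightarrow> 'v) \<Rightarrow> 'v set" where
  "escaping_set X N T = {x \<in> X. filterlim (\<lambda>n. N ((T ^^ n) x)) at_top sequentially}"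

definition wild :: "'v::ab_group_add set \<Rightarrow> ('v \<Rightarrow> real) \<Rightarrow> ('v \<Rightarrow> 'v) \<Rightarrow> bool" where
  "wild X N T \<longleftrightarrow>
     X = escaping_set X N T \<union> recurrent_set X N T \<and>
     Metric_space.mtopology X (\<lambda>x y. N (x - y)) interior_of recurrent_set X N T \<noteq> {} \<and>
     Metric_space.mtopology X (\<lambda>x y. N (x - y)) interior_of escaping_set X N T \<noteq> {}"


section \<open>Well-definedness\<close>

lemma lip_norm_le: "C-lipschitz_on UNIV \<phi> \<Longrightarrow> lip_norm \<phi> \<le> C"
  unfolding lip_norm_def
  by (rule cInf_lower) (auto intro!: bdd_belowI[of _ 0] dest: lipschitz_on_nonneg)

lemma lip_norm_nonneg: "C-lipschitz_on UNIV \<phi> \<Longrightarrow> 0 \<le> lip_norm \<phi>"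
  unfolding lip_norm_def by (rule cInf_greatest) (auto dest: lipschitz_on_nonneg)

lemma lipschitz_on_lip_norm:
  fixes \<phi> :: "'a::metric_space \<Rightarrow> 'k::real_normed_field"
  assumes "C-lipschitz_on UNIV \<phi>"
  shows "(lip_norm \<phi>)-lipschitz_on UNIV \<phi>"
proof (rule lipschitz_onI)
  fix x y :: 'a
  show "dist (\<phi> x) (\<phi> y) \<le> lip_norm \<phi> * dist x y"
  proof (cases "x = y")
    case False
    have "dist (\<phi> x) (\<phi> y) / dist x y \<le> lip_norm \<phi>"
      unfolding lip_norm_def
    proof (rule cInf_greatest)
      show "{C. C-lipschitz_on UNIV \<phi>} \<noteq> {}" using assms by auto
    next
      fix D assume "D \<in> {C. C-lipschitz_on UNIV \<phi>}"
      then have "dist (\<phi> x) (\<phi> y) \<le> D * dist x y" by (auto dest: lipschitz_onD)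
      then show "dist (\<phi> x) (\<phi> y) / dist x y \<le> D"
        using False by (simp add: divide_le_eq)
    qed
    then show ?thesis using False by (simp add: divide_le_eq)
  qed simp
qed (rule lip_norm_nonneg[OF assms])

lemma lipschitz_pscale:
  assumes "C-lipschitz_on UNIV (\<phi> :: 'a::metric_space \<Rightarrow> 'k::real_normed_field)"
  shows "(norm c * C)-lipschitz_on UNIV (pscale c \<phi>)"
proof (rule lipschitz_onI)
  fix x y
  have "dist (pscale c \<phi> x) (pscale c \<phi> y) = norm c * dist (\<phi> x) (\<phi> y)"
    by (simp add: pscale_def dist_norm norm_mult flip: right_diff_distrib)
  also have "\<dots> \<le> norm c * (C * dist x y)"
    using assms by (intro mult_left_mono) (auto dest: lipschitz_onD)
  finally show "dist (pscale c \<phi> x) (pscale c \<phi> y) \<le> norm c * C * dist x y"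
    by (simp add: mult.assoc)
qed (use assms in \<open>auto dest: lipschitz_on_nonneg\<close>)

lemma lip0_D:
  assumes "\<phi> \<in> lip0 e"
  shows "(lip_norm \<phi>)-lipschitz_on UNIV \<phi>" "\<phi> e = 0" "0 \<le> lip_norm \<phi>"
  using assms lipschitz_on_lip_norm lip_norm_nonneg by (auto simp: lip0_def)

lemma lip0_norm_le:
  assumes "\<phi> \<in> lip0 e" shows "norm (\<phi> x) \<le> dist x e * lip_norm \<phi>"
  using lipschitz_onD[OF lip0_D(1)[OF assms], of x e] lip0_D(2)[OF assms]
  by (simp add: mult.commute)

lemma lip0_zero: "0 \<in> lip0 e"
  by (auto simp: lip0_def lipschitz_on_def)

lemma lip0_pscale: "\<phi> \<in> lip0 e \<Longrightarrow> pscale c \<phi> \<in> lip0 e"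
  using lipschitz_pscale[of _ \<phi> c] by (auto simp: lip0_def) (auto simp: pscale_def)

lemma lip0_add:
  fixes \<phi> \<psi> :: "'a::metric_space \<Rightarrow> 'k::real_normed_field"
  assumes "\<phi> \<in> lip0 e" "\<psi> \<in> lip0 e" shows "\<phi> + \<psi> \<in> lip0 e"
proof -
  from assms obtain C D where "C-lipschitz_on UNIV \<phi>" "D-lipschitz_on UNIV \<psi>"
    by (auto simp: lip0_def)
  then have "(C + D)-lipschitz_on UNIV (\<lambda>x. \<phi> x + \<psi> x)"
    by (rule lipschitz_on_add)
  then show ?thesis using assms by (auto simp: lip0_def plus_fun_def)
qed

lemma lip_norm_pscale:
  assumes "\<phi> \<in> lip0 e" shows "lip_norm (pscale c \<phi>) \<le> norm c * lip_norm \<phi>"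
  by (rule lip_norm_le, rule lipschitz_pscale, rule lip0_D(1)[OF assms])

lemma dual_D:
  assumes "u \<in> lip0_dual e"
  shows "\<And>\<phi> \<psi>. \<phi> \<in> lip0 e \<Longrightarrow> \<psi> \<in> lip0 e \<Longrightarrow> u (\<phi> + \<psi>) = u \<phi> + u \<psi>"
    and "\<And>c \<phi>. \<phi> \<in> lip0 e \<Longrightarrow> u (pscale c \<phi>) = c * u \<phi>"
    and "\<exists>C. \<forall>\<phi>\<in>lip0 e. norm (u \<phi>) \<le> C * lip_norm \<phi>"
    and "\<And>\<phi>. \<phi> \<notin> lip0 e \<Longrightarrow> u \<phi> = 0"
  using assms by (auto simp: lip0_dual_def bounded_linear_on_def)

lemma dual_I:
  assumes "\<And>\<phi> \<psi>. \<phi> \<in> lip0 e \<Longrightarrow> \<psi> \<in> lip0 e \<Longrightarrow> u (\<phi> + \<psi>) = u \<phi> + u \<psi>"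
    and "\<And>c \<phi>. \<phi> \<in> lip0 e \<Longrightarrow> u (pscale c \<phi>) = c * u \<phi>"
    and "\<And>\<phi>. \<phi> \<in> lip0 e \<Longrightarrow> norm (u \<phi>) \<le> C * lip_norm \<phi>"
    and "\<And>\<phi>. \<phi> \<notin> lip0 e \<Longrightarrow> u \<phi> = 0"
  shows "u \<in> lip0_dual e"
  using assms by (auto simp: lip0_dual_def bounded_linear_on_def intro!: exI[of _ C])

lemma dual_norm_le:
  fixes u :: "('a::metric_space \<Rightarrow> 'b::real_normed_field) \<Rightarrow> 'b"
  assumes "u \<in> lip0_dual e" "0 \<le> C" "\<And>\<phi>. \<phi> \<in> lip0 e \<Longrightarrow> norm (u \<phi>) \<le> C * lip_norm \<phi>"
  shows "dual_norm e u \<le> C"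
proof -
  have "(SUP \<phi>\<in>{\<phi> \<in> lip0 e. lip_norm \<phi> \<le> 1}. norm (u \<phi>)) \<le> C"
  proof (rule cSUP_least)
    have "lip_norm (0 :: 'a \<Rightarrow> 'b) \<le> 0"
      by (rule lip_norm_le) (auto simp: lipschitz_on_def)
    then show "{\<phi> \<in> lip0 e. lip_norm \<phi> \<le> 1} \<noteq> ({} :: ('a \<Rightarrow> 'b) set)"
      using lip0_zero[of e, where 'b='b] by force
  next
    fix \<phi> :: "'a \<Rightarrow> 'b" assume a: "\<phi> \<in> {\<phi> \<in> lip0 e. lip_norm \<phi> \<le> 1}"
    then have "norm (u \<phi>) \<le> C * lip_norm \<phi>" using assms(3) by auto
    also have "\<dots> \<le> C * 1" using a assms(2) by (intro mult_left_mono) auto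
    finally show "norm (u \<phi>) \<le> C" by simp
  qed
  then show ?thesis using assms(1) by (simp add: dual_norm_def)
qed

lemma norm_le_dual_norm_unit:
  fixes u :: "('a::metric_space \<Rightarrow> 'b::real_normed_field) \<Rightarrow> 'b"
  assumes "u \<in> lip0_dual e" "\<phi> \<in> lip0 e" "lip_norm \<phi> \<le> 1"
  shows "norm (u \<phi>) \<le> dual_norm e u"
proof -
  obtain C where C: "\<And>\<phi>. \<phi> \<in> lip0 e \<Longrightarrow> norm (u \<phi>) \<le> C * lip_norm \<phi>"
    using dual_D(3)[OF assms(1)] by auto
  have "bdd_above ((\<lambda>\<phi>. norm (u \<phi>)) ` {\<phi> \<in> lip0 e. lip_norm \<phi> \<le> 1})"
  proof (rule bdd_aboveI2[of _ _ "max C 0"])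
    fix \<phi> :: "'a \<Rightarrow> 'b" assume a: "\<phi> \<in> {\<phi> \<in> lip0 e. lip_norm \<phi> \<le> 1}"
    have "norm (u \<phi>) \<le> C * lip_norm \<phi>" using a C by auto
    also have "\<dots> \<le> max C 0 * lip_norm \<phi>"
      using a lip0_D(3) by (intro mult_right_mono) auto
    also have "\<dots> \<le> max C 0 * 1" using a by (intro mult_left_mono) auto
    finally show "norm (u \<phi>) \<le> max C 0" by simp
  qed
  then show ?thesis
    unfolding dual_norm_def using assms by (auto intro!: cSUP_upper)
qed

lemma norm_le_dual_norm:
  fixes u :: "('a::metric_space \<Rightarrow> 'k::real_normed_field) \<Rightarrow> 'k"
  assumes "u \<in> lip0_dual e" "\<phi> \<in> lip0 e"
  shows "norm (u \<phi>) \<le> dual_norm e u * lip_norm \<phi>"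
proof (cases "lip_norm \<phi> = 0")
  case True
  then have "norm (u \<phi>) \<le> 0" using dual_D(3)[OF assms(1)] assms(2) by force
  then show ?thesis using True by simp
next
  case False
  with lip0_D(3)[OF assms(2)] have pos: "0 < lip_norm \<phi>" by simp
  define c :: 'k where "c = of_real (1 / lip_norm \<phi>)"
  have nc: "norm c = 1 / lip_norm \<phi>" using pos by (simp add: c_def norm_divide)
  have "lip_norm (pscale c \<phi>) \<le> 1"
    using lip_norm_pscale[OF assms(2), of c] pos by (simp add: nc)
  then have "norm (u (pscale c \<phi>)) \<le> dual_norm e u"
    by (intro norm_le_dual_norm_unit assms lip0_pscale)
  then have "norm c * norm (u \<phi>) \<le> dual_norm e u"
    by (simp add: dual_D(2)[OF assms] norm_mult)
  then show ?thesis using pos by (simp add: nc field_simps)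
qed

lemma dual_norm_nonneg: "0 \<le> dual_norm e (u :: ('a::metric_space \<Rightarrow> 'k::real_normed_field) \<Rightarrow> 'k)"
proof (cases "u \<in> lip0_dual e")
  case True
  have "lip_norm (0 :: 'a \<Rightarrow> 'k) \<le> 0"
    by (rule lip_norm_le) (auto simp: lipschitz_on_def)
  then have "norm (u 0) \<le> dual_norm e u"
    using norm_le_dual_norm_unit[OF True lip0_zero] by simp
  then show ?thesis using norm_ge_zero[of "u 0"] by linarith
qed (simp add: dual_norm_def)

lemma dual_pscale:
  fixes u :: "('a::metric_space \<Rightarrow> 'b::real_normed_field) \<Rightarrow> 'b"
  assumes "u \<in> lip0_dual e" shows "pscale c u \<in> lip0_dual e"
proof (rule dual_I)
  fix \<phi> :: "'a \<Rightarrow> 'b" assume "\<phi> \<in> lip0 e"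
  then show "norm (pscale c u \<phi>) \<le> (norm c * dual_norm e u) * lip_norm \<phi>"
    using norm_le_dual_norm[OF assms, of \<phi>]
    by (simp add: pscale_def norm_mult mult.assoc mult_left_mono)
qed (auto simp: pscale_def dual_D[OF assms, unfolded pscale_def] algebra_simps)

lemma dual_add_strong:
  assumes "u \<in> lip0_dual e" "v \<in> lip0_dual e"
  shows "u + v \<in> lip0_dual e \<and> dual_norm e (u + v) \<le> dual_norm e u + dual_norm e v"
proof -
  have *: "norm ((u + v) \<phi>) \<le> (dual_norm e u + dual_norm e v) * lip_norm \<phi>" if "\<phi> \<in> lip0 e" for \<phi>
    using norm_le_dual_norm[OF assms(1) that] norm_le_dual_norm[OF assms(2) that]
      norm_triangle_ineq[of "u \<phi>" "v \<phi>"] by (simp add: algebra_simps)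
  have "u + v \<in> lip0_dual e"
    by (rule dual_I[OF _ _ *]) (auto simp: dual_D[OF assms(1)] dual_D[OF assms(2)] algebra_simps)
  with * show ?thesis by (auto intro!: dual_norm_le add_nonneg_nonneg dual_norm_nonneg)
qed

lemmas dual_add = dual_add_strong[THEN conjunct1]
  and dual_norm_triangle = dual_add_strong[THEN conjunct2]

lemma dual_zero: "0 \<in> lip0_dual e"
  by (rule dual_I[where C=0]) auto

lemma subspace_dual: "pointwise.subspace (lip0_dual e)"
  by (auto simp: pointwise.subspace_def dual_zero dual_add dual_pscale)

lemmas dual_diff = pointwise.subspace_diff[OF subspace_dual]

lemma dual_norm_minus: "dual_norm e (u - v) = dual_norm e (v - u)"
proof -
  have "v - u \<in> lip0_dual e \<longleftrightarrow> u - v \<in> lip0_dual e"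
    using pointwise.subspace_neg[OF subspace_dual, of "u - v" e]
      pointwise.subspace_neg[OF subspace_dual, of "v - u" e] by auto
  then show ?thesis by (auto simp: dual_norm_def norm_minus_commute)
qed

lemma dual_norm_eq_0:
  assumes "u \<in> lip0_dual e" "dual_norm e u = 0" shows "u = 0"
proof
  fix \<phi> show "u \<phi> = 0 \<phi>"
    using norm_le_dual_norm[OF assms(1), of \<phi>] dual_D(4)[OF assms(1)] assms(2)
    by (cases "\<phi> \<in> lip0 e") auto
qed

lemma dual_norm_zero [simp]:
  "dual_norm e (0 :: ('a::metric_space \<Rightarrow> 'b::real_normed_field) \<Rightarrow> 'b) = 0"
  using dual_norm_le[OF dual_zero[where 'b='b], of 0 e] dual_norm_nonneg[where 'k='b, of e 0]
  by simp

lemma Metric_space_dual: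
  "Metric_space (lip0_dual e :: (('a::metric_space \<Rightarrow> 'b::real_normed_field) \<Rightarrow> 'b) set)
     (\<lambda>u v. dual_norm e (u - v))"
proof
  fix u v w :: "('a \<Rightarrow> 'b) \<Rightarrow> 'b"
  show "dual_norm e (u - v) = dual_norm e (v - u)" by (rule dual_norm_minus)
  assume uv: "u \<in> lip0_dual e" "v \<in> lip0_dual e"
  show "dual_norm e (u - v) = 0 \<longleftrightarrow> u = v"
    using dual_norm_eq_0[OF dual_diff[OF uv]] by auto
  assume w: "w \<in> lip0_dual e"
  show "dual_norm e (u - w) \<le> dual_norm e (u - v) + dual_norm e (v - w)"
    using dual_norm_triangle[OF dual_diff[OF uv] dual_diff[OF uv(2) w]] by simp
qed (rule dual_norm_nonneg)

lemma delta_dual: "delta e x \<in> lip0_dual e"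
  by (rule dual_I[where C = "dist x e"])
    (auto simp: delta_def lip0_add lip0_pscale lip0_norm_le, auto simp: pscale_def)

lemma span_dual: "pointwise.span (range (delta e)) \<subseteq> lip0_dual e"
  by (rule pointwise.span_minimal) (auto simp: delta_dual subspace_dual)

lemma lip_free_iff:
  "u \<in> lip_free e \<longleftrightarrow> u \<in> lip0_dual e \<and>
     (\<forall>r>0. \<exists>v\<in>pointwise.span (range (delta e)). dual_norm e (u - v) < r)"
  unfolding lip_free_def Metric_space.metric_closure_of[OF Metric_space_dual]
    Metric_space.in_mball[OF Metric_space_dual]
  using span_dual by blast

lemma lip_free_dual: "u \<in> lip_free e \<Longrightarrow> u \<in> lip0_dual e"
  by (simp add: lip_free_iff)

lemma Metric_space_lip_free: "Metric_space (lip_free e) (\<lambda>u v. dual_norm e (u - v))"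
  by (rule Metric_space.subspace[OF Metric_space_dual]) (auto intro: lip_free_dual)

lemma span_lip_free: "u \<in> pointwise.span (range (delta e)) \<Longrightarrow> u \<in> lip_free e"
  using span_dual[of e] by (auto simp: lip_free_iff intro!: bexI[of _ u])

lemma dual_norm_pscale:
  fixes u :: "('a::metric_space \<Rightarrow> 'b::real_normed_field) \<Rightarrow> 'b"
  assumes "u \<in> lip0_dual e" shows "dual_norm e (pscale c u) \<le> norm c * dual_norm e u"
proof (rule dual_norm_le[OF dual_pscale[OF assms]])
  fix \<phi> :: "'a \<Rightarrow> 'b" assume "\<phi> \<in> lip0 e"
  then show "norm (pscale c u \<phi>) \<le> (norm c * dual_norm e u) * lip_norm \<phi>"
    using norm_le_dual_norm[OF assms, of \<phi>]
    by (simp add: pscale_def norm_mult mult.assoc mult_left_mono)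
qed (simp add: dual_norm_nonneg)

lemma subspace_lip_free:
  "pointwise.subspace (lip_free e :: (('a::metric_space \<Rightarrow> 'b::real_normed_field) \<Rightarrow> 'b) set)"
  unfolding pointwise.subspace_def
proof (intro conjI ballI allI)
  show "0 \<in> lip_free e" by (rule span_lip_free) (rule pointwise.span_zero)
next
  fix u v :: "('a \<Rightarrow> 'b) \<Rightarrow> 'b" assume u: "u \<in> lip_free e" and v: "v \<in> lip_free e"
  show "u + v \<in> lip_free e"
    unfolding lip_free_iff
  proof (intro conjI allI impI)
    show "u + v \<in> lip0_dual e" using u v by (intro dual_add lip_free_dual)
    fix r :: real assume "r > 0"
    then have "r / 2 > 0" by simp
    then obtain a b where ab: "a \<in> pointwise.span (range (delta e))" "dual_norm e (u - a) < r/2"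
       "b \<in> pointwise.span (range (delta e))" "dual_norm e (v - b) < r/2"
      using u v unfolding lip_free_iff by meson
    then have "dual_norm e ((u - a) + (v - b)) < r"
      using dual_norm_triangle[of "u - a" e "v - b"] dual_diff[of u e a] dual_diff[of v e b]
        lip_free_dual[OF u] lip_free_dual[OF v] span_dual[of e] by fastforce
    then show "\<exists>w\<in>pointwise.span (range (delta e)). dual_norm e (u + v - w) < r"
      using ab by (intro bexI[of _ "a + b"]) (auto simp: pointwise.span_add add_diff_add)
  qed
next
  fix c :: 'b and u :: "('a \<Rightarrow> 'b) \<Rightarrow> 'b" assume u: "u \<in> lip_free e"
  show "pscale c u \<in> lip_free e"
    unfolding lip_free_iff
  proof (intro conjI allI impI)
    show "pscale c u \<in> lip0_dual e" using u by (intro dual_pscale lip_free_dual)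
    fix r :: real assume "r > 0"
    then have "r / (norm c + 1) > 0" by (simp add: add_nonneg_pos)
    then obtain a where a: "a \<in> pointwise.span (range (delta e))"
        "dual_norm e (u - a) < r / (norm c + 1)"
      using u unfolding lip_free_iff by meson
    have "dual_norm e (pscale c (u - a)) \<le> norm c * dual_norm e (u - a)"
      using a span_dual[of e] lip_free_dual[OF u] by (intro dual_norm_pscale dual_diff) auto
    also have "\<dots> \<le> (norm c + 1) * dual_norm e (u - a)"
      by (intro mult_right_mono) (auto simp: dual_norm_nonneg)
    also have "\<dots> < r"
      using a(2) by (simp add: pos_less_divide_eq add_nonneg_pos mult.commute)
    finally show "\<exists>w\<in>pointwise.span (range (delta e)). dual_norm e (pscale c u - w) < r"
      using a by (intro bexI[of _ "pscale c a"])
        (auto simp: pointwise.span_scale pointwise.scale_right_diff_distrib)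
  qed
qed

lemma lip_free_map_unique:
  fixes T S :: "(('a::metric_space \<Rightarrow> 'k::real_normed_field) \<Rightarrow> 'k) \<Rightarrow> (('a \<Rightarrow> 'k) \<Rightarrow> 'k)"
  assumes T: "is_lip_free_map f e T" and S: "is_lip_free_map f e S"
  shows "T = S"
proof (rule extensionalityI)
  show "T \<in> extensional (lip_free e)" "S \<in> extensional (lip_free e)"
    using T S by (auto simp: is_lip_free_map_def)
next
  fix u :: "('a \<Rightarrow> 'k) \<Rightarrow> 'k" assume u: "u \<in> lip_free e"
  define D where "D = (\<lambda>w. T w - S w)"
  have add: "D (w + w') = D w + D w'" if "w \<in> lip_free e" "w' \<in> lip_free e" for w w'
    using T S that unfolding D_def is_lip_free_map_def bounded_linear_on_def by simp
  have scale: "D (pscale c w) = pscale c (D w)" if "w \<in> lip_free e" for c w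
    using T S that unfolding D_def is_lip_free_map_def bounded_linear_on_def
    by (simp add: pointwise.scale_right_diff_distrib)
  have dual: "D w \<in> lip0_dual e" "T w \<in> lip0_dual e" "S w \<in> lip0_dual e"
    if "w \<in> lip_free e" for w
    using T S that unfolding D_def is_lip_free_map_def bounded_linear_on_def
    by (auto simp: Pi_iff intro!: dual_diff intro: lip_free_dual)
  obtain A B where A: "\<And>w. w \<in> lip_free e \<Longrightarrow> dual_norm e (T w) \<le> A * dual_norm e w"
      and B: "\<And>w. w \<in> lip_free e \<Longrightarrow> dual_norm e (S w) \<le> B * dual_norm e w"
    using T S unfolding is_lip_free_map_def bounded_linear_on_def by meson
  have bound: "dual_norm e (D w) \<le> (A + B) * dual_norm e w" if w: "w \<in> lip_free e" for w
    using dual_norm_triangle[of "T w" e "0 - S w"] dual_norm_minus[of e 0 "S w"]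
      dual_diff[OF dual_zero dual(3)[OF w]] dual(2)[OF w] A[OF w] B[OF w]
    by (simp add: D_def algebra_simps)
  have span: "w \<in> lip_free e \<and> D w = 0" if "w \<in> pointwise.span (range (delta e))" for w
    using that
  proof (induction rule: pointwise.span_induct_alt)
    case base
    have "D (pscale 0 0) = pscale 0 (D 0)"
      by (rule scale) (rule pointwise.subspace_0[OF subspace_lip_free])
    then have "0 \<in> lip_free e \<and> D 0 = 0" using pointwise.subspace_0[OF subspace_lip_free] by simp
    then show ?case .
  next
    case (step c x y)
    then obtain z where z: "x = delta e z" by auto
    have x: "x \<in> lip_free e" unfolding z by (intro span_lip_free pointwise.span_base) auto
    have "D x = 0" using T S unfolding z D_def is_lip_free_map_def by simp
    have y: "y \<in> lip_free e" "D y = 0" using step.IH by (auto simp: fun_eq_iff)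
    have "pscale c x + y \<in> lip_free e \<and> D (pscale c x + y) = 0"
      using x y \<open>D x = 0\<close> add[OF pointwise.subspace_scale[OF subspace_lip_free x]] scale[OF x]
      by (auto intro!: pointwise.subspace_add[OF subspace_lip_free]
          pointwise.subspace_scale[OF subspace_lip_free])
    then show ?case .
  qed
  have "dual_norm e (D u) \<le> 0 + r" if "r > 0" for r
  proof -
    have "r / (\<bar>A + B\<bar> + 1) > 0" using that by simp
    then obtain w where w: "w \<in> pointwise.span (range (delta e))"
        "dual_norm e (u - w) < r / (\<bar>A + B\<bar> + 1)"
      using u unfolding lip_free_iff by meson
    have uw: "u - w \<in> lip_free e"
      using u span[OF w(1)] by (intro pointwise.subspace_diff[OF subspace_lip_free]) auto
    have "D ((u - w) + w) = D (u - w) + D w" using span[OF w(1)] by (intro add[OF uw]) simp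
    then have "D u = D (u - w)" using span[OF w(1)] by simp
    then have "dual_norm e (D u) \<le> (A + B) * dual_norm e (u - w)"
      using bound[OF uw] by simp
    also have "\<dots> \<le> (\<bar>A + B\<bar> + 1) * dual_norm e (u - w)"
      by (intro mult_right_mono) (auto simp: dual_norm_nonneg)
    also have "\<dots> < r" using w(2) by (simp add: pos_less_divide_eq mult.commute)
    finally show ?thesis by simp
  qed
  then have "dual_norm e (D u) \<le> 0" by (rule field_le_epsilon)
  then have "D u = 0"
    using dual_norm_eq_0[OF dual(1)[OF u]] dual_norm_nonneg[of e "D u"] by simp
  then show "T u = S u" by (simp add: D_def)
qed

lemma lip_free_map_exists:
  fixes f :: "'a::metric_space \<Rightarrow> 'a"
  assumes "L-lipschitz_on UNIV f"
  shows "\<exists>T :: (('a \<Rightarrow> 'k::real_normed_field) \<Rightarrow> 'k) \<Rightarrow> (('a \<Rightarrow> 'k) \<Rightarrow> 'k). is_lip_free_map f e T"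
proof -
  define p :: "('a \<Rightarrow> 'k) \<Rightarrow> 'a \<Rightarrow> 'k" where "p = (\<lambda>\<phi> x. \<phi> (f x) - \<phi> (f e))"
  define R :: "(('a \<Rightarrow> 'k) \<Rightarrow> 'k) \<Rightarrow> (('a \<Rightarrow> 'k) \<Rightarrow> 'k)"
    where "R = (\<lambda>u \<phi>. if \<phi> \<in> lip0 e then u (p \<phi>) else 0)"
  have L: "0 \<le> L" using assms by (rule lipschitz_on_nonneg)
  have pl: "(L * lip_norm \<phi>)-lipschitz_on UNIV (p \<phi>)" if "\<phi> \<in> lip0 e" for \<phi>
  proof (rule lipschitz_onI)
    fix x y
    have "dist (p \<phi> x) (p \<phi> y) = dist (\<phi> (f x)) (\<phi> (f y))"
      by (simp add: p_def dist_norm)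
    also have "\<dots> \<le> lip_norm \<phi> * dist (f x) (f y)"
      using lipschitz_onD[OF lip0_D(1)[OF that]] by simp
    also have "\<dots> \<le> lip_norm \<phi> * (L * dist x y)"
      using lipschitz_onD[OF assms] lip0_D(3)[OF that] by (intro mult_left_mono) auto
    finally show "dist (p \<phi> x) (p \<phi> y) \<le> L * lip_norm \<phi> * dist x y"
      by (simp add: algebra_simps)
  qed (use L lip0_D(3)[OF that] in auto)
  have p0: "p \<phi> \<in> lip0 e" and pn: "lip_norm (p \<phi>) \<le> L * lip_norm \<phi>" if "\<phi> \<in> lip0 e" for \<phi>
    using pl[OF that] by (auto simp: lip0_def p_def intro: lip_norm_le)
  have padd: "p (\<phi> + \<psi>) = p \<phi> + p \<psi>" and psc: "p (pscale c \<phi>) = pscale c (p \<phi>)" for \<phi> \<psi> c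
    by (auto simp: p_def pscale_def fun_eq_iff algebra_simps)
  have Rb: "norm (R u \<phi>) \<le> (L * dual_norm e u) * lip_norm \<phi>"
    if "u \<in> lip0_dual e" "\<phi> \<in> lip0 e" for u \<phi>
  proof -
    have "norm (u (p \<phi>)) \<le> dual_norm e u * lip_norm (p \<phi>)"
      using that p0 by (intro norm_le_dual_norm)
    also have "\<dots> \<le> dual_norm e u * (L * lip_norm \<phi>)"
      using pn[OF that(2)] by (intro mult_left_mono dual_norm_nonneg)
    finally show ?thesis using that by (simp add: R_def algebra_simps)
  qed
  have Rd: "R u \<in> lip0_dual e" if "u \<in> lip0_dual e" for u
    by (rule dual_I[OF _ _ Rb[OF that]])
      (auto simp: R_def lip0_add lip0_pscale padd psc dual_D[OF that] p0)
  have Rn: "dual_norm e (R u) \<le> L * dual_norm e u" if "u \<in> lip0_dual e" for u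
    using Rd[OF that] Rb[OF that] L by (intro dual_norm_le) (auto simp: dual_norm_nonneg)
  have Radd: "R (u + v) = R u + R v" and Rdiff: "R (u - v) = R u - R v"
    and Rsc: "R (pscale c u) = pscale c (R u)" for u v c
    by (auto simp: R_def fun_eq_iff pscale_def)
  have Rdelta: "R (delta e x) = delta e (f x) - delta e (f e)" for x
    by (auto simp: R_def fun_eq_iff delta_def p0) (auto simp: p_def)
  have Rspan: "R u \<in> pointwise.span (range (delta e))"
    if "u \<in> pointwise.span (range (delta e))" for u
    using that
  proof (induction rule: pointwise.span_induct_alt)
    case base
    have "R 0 = 0" by (auto simp: R_def fun_eq_iff)
    then show ?case using pointwise.span_zero by metis
  next
    case (step c x y)
    then obtain z where "x = delta e z" by auto
    then have "R (pscale c x + y) = pscale c (delta e (f z) - delta e (f e)) + R y"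
      by (simp only: Radd Rsc Rdelta)
    also have "\<dots> \<in> pointwise.span (range (delta e))"
      by (intro pointwise.span_add pointwise.span_scale pointwise.span_diff pointwise.span_base
          rangeI step.IH)
    finally show ?case .
  qed
  have RF: "R u \<in> lip_free e" if u: "u \<in> lip_free e" for u
    unfolding lip_free_iff
  proof (intro conjI allI impI)
    show "R u \<in> lip0_dual e" by (intro Rd lip_free_dual u)
    fix r :: real assume "r > 0"
    then have "r / (L + 1) > 0" using L by simp
    then obtain w where w: "w \<in> pointwise.span (range (delta e))" "dual_norm e (u - w) < r / (L + 1)"
      using u unfolding lip_free_iff by meson
    have "dual_norm e (R u - R w) \<le> L * dual_norm e (u - w)"
      unfolding Rdiff[symmetric]
      using w span_dual[of e] lip_free_dual[OF u] by (intro Rn dual_diff) auto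
    also have "\<dots> \<le> (L + 1) * dual_norm e (u - w)"
      by (intro mult_right_mono) (auto simp: dual_norm_nonneg)
    also have "\<dots> < r" using w(2) L by (simp add: pos_less_divide_eq mult.commute)
    finally show "\<exists>v\<in>pointwise.span (range (delta e)). dual_norm e (R u - v) < r"
      using Rspan[OF w(1)] by blast
  qed
  have dF: "delta e x \<in> lip_free e" for x
    by (intro span_lip_free pointwise.span_base) auto
  have "is_lip_free_map f e (restrict R (lip_free e))"
    unfolding is_lip_free_map_def bounded_linear_on_def
    using Rn lip_free_dual
    by (auto simp: RF dF Rdelta Radd Rsc pointwise.subspace_add[OF subspace_lip_free]
        pointwise.subspace_scale[OF subspace_lip_free] intro!: exI[of _ L])
  then show ?thesis by blast
qed

lemma is_lip_free_map_lip_free_map: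
  assumes "L-lipschitz_on UNIV f"
  shows "is_lip_free_map f e (lip_free_map f e)"
proof -
  have "\<exists>!T. is_lip_free_map f e T"
    using lip_free_map_exists[OF assms] lip_free_map_unique by (rule ex_ex1I)
  then show ?thesis unfolding lip_free_map_def by (rule theI')
qed

end

theory Submission
  imports Defs "HOL-Library.Nat_Bijection"
begin

text \<open>Suppose the recurrent set has an interior point. For any finite set \<open>F\<close> of points containing
  the base point and the support of a suitable finitely supported interior point, a small
  perturbation yields a recurrent \<open>u = (\<Sum>p\<in>F. a p \<cdot> \<delta>(p))\<close> with \<open>(\<Sum>p\<in>F. a p) = 0\<close> in which no
  coefficient \<open>a p\<close> is the sum of other coefficients. Then \<open>T\<^sup>n u = (\<Sum>p\<in>F. a p \<cdot> \<delta>(f\<^sup>n p))\<close>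
  can be close to \<open>u\<close> only if \<open>f\<^sup>n p\<close> is close to \<open>p\<close> for every \<open>p \<in> F\<close>. Hence arbitrary finite
  sets of points are jointly recurrent under \<open>f\<close>, so no finitely supported element escapes; as these
  are dense, the escaping set has empty interior.\<close>

section \<open>Finite combinations of evaluation functionals and their dual norm\<close>

text \<open>The index set is kept apart from the points so that iterating \<open>f\<close> changes
  only \<open>x\<close>, never \<open>F\<close> or \<open>a\<close>, even when several indices are
  sent to the same point.\<close>

definition delta_sum ::
  "'a::metric_space \<Rightarrow> 'i set \<Rightarrow> ('i \<Rightarrow> 'k::real_normed_field) \<Rightarrow> ('i \<Rightarrow> 'a) \<Rightarrow> ('a \<Rightarrow> 'k) \<Rightarrow> 'k"
  where "delta_sum e F a x = (\<Sum>q\<in>F. pscale (a q) (delta e (x q)))"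

lemma sum_fun_apply: "sum g F \<phi> = (\<Sum>q\<in>F. g q \<phi>)" for g :: "'i \<Rightarrow> 'b \<Rightarrow> 'k::comm_monoid_add"
  by (induction F rule: infinite_finite_induct) auto

lemma delta_sum_apply: "\<phi> \<in> lip0 e \<Longrightarrow> delta_sum e F a x \<phi> = (\<Sum>q\<in>F. a q * \<phi> (x q))"
  by (simp add: delta_sum_def sum_fun_apply pscale_def delta_def)

lemma delta_base_point [simp]: "delta e e = 0"
  by (auto simp: delta_def fun_eq_iff lip0_def)

lemma delta_sum_span: "delta_sum e F a x \<in> pointwise.span (range (delta e))"
  unfolding delta_sum_def
  by (intro pointwise.span_sum pointwise.span_scale pointwise.span_base rangeI)

lemma delta_sum_dual: "delta_sum e F a x \<in> lip0_dual e"
  using delta_sum_span span_dual by blast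

text \<open>Zero total mass makes the sums blind to constants, so the test function may be
  normalised to vanish at \<open>e\<close>. Hence any Lipschitz function can serve as a
  test.\<close>

lemma dual_norm_delta_sum_diff_ge:
  fixes \<phi> :: "'a::metric_space \<Rightarrow> 'k::real_normed_field"
  assumes "sum a F = 0" and \<phi>: "C-lipschitz_on UNIV \<phi>"
  shows "norm ((\<Sum>q\<in>F. a q * \<phi> (x q)) - (\<Sum>q\<in>F. a q * \<phi> (y q)))
    \<le> dual_norm e (delta_sum e F a x - delta_sum e F a y) * C"
proof -
  define \<psi> where "\<psi> = (\<lambda>z. \<phi> z - \<phi> e)"
  have lip: "C-lipschitz_on UNIV \<psi>"
    using \<phi> by (auto simp: lipschitz_on_def \<psi>_def dist_norm)
  then have \<psi>: "\<psi> \<in> lip0 e" by (auto simp: lip0_def \<psi>_def)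
  have *: "(\<Sum>q\<in>F. a q * \<psi> (z q)) = (\<Sum>q\<in>F. a q * \<phi> (z q))" for z
    using assms(1) by (simp add: \<psi>_def right_diff_distrib sum_subtractf flip: sum_distrib_right)
  have "norm ((delta_sum e F a x - delta_sum e F a y) \<psi>)
      \<le> dual_norm e (delta_sum e F a x - delta_sum e F a y) * lip_norm \<psi>"
    by (intro norm_le_dual_norm dual_diff delta_sum_dual \<psi>)
  also have "\<dots> \<le> dual_norm e (delta_sum e F a x - delta_sum e F a y) * C"
    by (intro mult_left_mono lip_norm_le lip dual_norm_nonneg)
  finally show ?thesis by (simp add: delta_sum_apply[OF \<psi>] *)
qed

lemma dual_norm_delta_sum_diff_le:
  fixes a :: "'i \<Rightarrow> 'k::real_normed_field"
  shows "dual_norm e (delta_sum e F a x - delta_sum e F a y)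
    \<le> (\<Sum>q\<in>F. norm (a q) * dist (x q) (y q))"
proof (rule dual_norm_le)
  show "delta_sum e F a x - delta_sum e F a y \<in> lip0_dual e"
    by (intro dual_diff delta_sum_dual)
  fix \<phi> :: "'a \<Rightarrow> 'k" assume \<phi>: "\<phi> \<in> lip0 e"
  have "norm (\<Sum>q\<in>F. a q * (\<phi> (x q) - \<phi> (y q)))
      \<le> (\<Sum>q\<in>F. norm (a q) * (lip_norm \<phi> * dist (x q) (y q)))"
    using lipschitz_onD[OF lip0_D(1)[OF \<phi>]]
    by (intro sum_norm_le) (auto simp: norm_mult dist_norm intro!: mult_left_mono)
  then show "norm ((delta_sum e F a x - delta_sum e F a y) \<phi>)
      \<le> (\<Sum>q\<in>F. norm (a q) * dist (x q) (y q)) * lip_norm \<phi>"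
    by (simp add: delta_sum_apply[OF \<phi>] right_diff_distrib sum_subtractf sum_distrib_left
        mult_ac)
qed (auto intro: sum_nonneg)

lemma delta_sum_mono_neutral:
  assumes "finite G" "F \<subseteq> G" "\<And>q. q \<notin> F \<Longrightarrow> a q = 0"
  shows "delta_sum e F a x = delta_sum e G a x"
  unfolding delta_sum_def using assms by (intro sum.mono_neutral_left) auto

text \<open>As \<delta>(e) = 0, the coefficient at \<open>e\<close> is free and can be chosen to
  make the total zero.\<close>

lemma span_delta_cases:
  fixes u :: "('a::metric_space \<Rightarrow> 'k::real_normed_field) \<Rightarrow> 'k"
  assumes "u \<in> pointwise.span (range (delta e))"
  obtains F a where "finite F" "e \<in> F" "\<And>q. q \<notin> F \<Longrightarrow> a q = 0" "sum a F = 0"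
    "u = delta_sum e F a (\<lambda>q. q)"
proof -
  define P where "P = (\<lambda>u :: ('a \<Rightarrow> 'k) \<Rightarrow> 'k. \<exists>F a. finite F \<and> e \<in> F \<and> (\<forall>q. q \<notin> F \<longrightarrow> a q = 0) \<and>
    sum a F = 0 \<and> u = delta_sum e F a (\<lambda>q. q))"
  have "P u"
    using assms
  proof (induction rule: pointwise.span_induct_alt)
    case base
    show ?case unfolding P_def
      by (rule exI[of _ "{e}"], rule exI[of _ "\<lambda>_. 0"]) (simp add: delta_sum_def)
  next
    case (step c x y)
    then obtain z where z: "x = delta e z" by auto
    from step.IH obtain F a where F: "finite F" "e \<in> F" "\<forall>q. q \<notin> F \<longrightarrow> a q = 0" "sum a F = 0"
      and y: "y = delta_sum e F a (\<lambda>q. q)" unfolding P_def by blast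
    define G where "G = insert z F"
    \<comment> \<open>The mass \<open>c\<close> added at \<open>z\<close> is taken away at
      \<open>e\<close>, where it does not change the functional. If \<open>z = e\<close>, the two
      corrections cancel.\<close>
    define b where "b = (\<lambda>q. (a q + (if q = z then c else 0)) - (if q = e then c else 0))"
    have G: "finite G" "e \<in> G" "z \<in> G" "\<forall>q. q \<notin> G \<longrightarrow> b q = 0"
      using F by (auto simp: G_def b_def)
    have "sum a G = sum a F"
      using F by (intro sum.mono_neutral_right) (auto simp: G_def)
    then have sb: "sum b G = 0"
      using G F by (simp add: b_def sum.distrib sum_subtractf)
    have "delta_sum e G b (\<lambda>q. q) = delta_sum e G a (\<lambda>q. q) +
        (\<Sum>q\<in>G. if q = z then pscale c (delta e q) else 0)
        - (\<Sum>q\<in>G. if q = e then pscale c (delta e q) else 0)"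
      unfolding delta_sum_def sum.distrib[symmetric] sum_subtractf[symmetric] b_def
      by (intro sum.cong refl)
        (auto simp: pointwise.scale_left_distrib pointwise.scale_left_diff_distrib)
    also have "\<dots> = pscale c x + y"
      using G F delta_sum_mono_neutral[of G F a e "\<lambda>q. q"]
      by (simp add: z y G_def subset_insertI)
    finally have "P (pscale c x + y)"
      unfolding P_def using G sb by (intro exI[of _ G] exI[of _ b] conjI) simp_all
    then show ?case .
  qed
  then show thesis using that unfolding P_def by blast
qed

section \<open>Iterates of the operator on finite combinations\<close>

lemma is_lip_free_map_D:
  assumes "is_lip_free_map f e T"
  shows "\<And>u. u \<in> lip_free e \<Longrightarrow> T u \<in> lip_free e"
    and "\<And>u v. u \<in> lip_free e \<Longrightarrow> v \<in> lip_free e \<Longrightarrow> T (u + v) = T u + T v"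
    and "\<And>c u. u \<in> lip_free e \<Longrightarrow> T (pscale c u) = pscale c (T u)"
    and "\<And>x. T (delta e x) = delta e (f x) - delta e (f e)"
  using assms unfolding is_lip_free_map_def bounded_linear_on_def by auto

lemma is_lip_free_map_delta_sum:
  fixes T :: "(('a::metric_space \<Rightarrow> 'k::real_normed_field) \<Rightarrow> 'k) \<Rightarrow> (('a \<Rightarrow> 'k) \<Rightarrow> 'k)"
  assumes T: "is_lip_free_map f e T" and "finite F"
  shows "T (delta_sum e F a x) = delta_sum e F a (\<lambda>q. f (x q)) - pscale (sum a F) (delta e (f e))"
  using assms(2)
proof (induction F rule: finite_induct)
  case empty
  have "T (pscale 0 0) = pscale 0 (T 0)"
    by (rule is_lip_free_map_D(3)[OF T]) (rule pointwise.subspace_0[OF subspace_lip_free])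
  then show ?case by (simp add: delta_sum_def zero_fun_def)
next
  case (insert p F)
  have d: "delta e (x p) \<in> lip_free e" by (intro span_lip_free pointwise.span_base) auto
  have sum_insert: "delta_sum e (insert p F) a y = pscale (a p) (delta e (y p)) + delta_sum e F a y" for y
    unfolding delta_sum_def by (rule sum.insert[OF insert.hyps])
  have "T (delta_sum e (insert p F) a x)
      = pscale (a p) (delta e (f (x p)) - delta e (f e)) + T (delta_sum e F a x)"
    unfolding sum_insert using is_lip_free_map_D[OF T] d pointwise.subspace_scale[OF subspace_lip_free d]
      span_lip_free[OF delta_sum_span] by metis
  then show ?case
    unfolding insert.IH sum_insert sum.insert[OF insert.hyps] pointwise.scale_right_diff_distrib
      pointwise.scale_left_distrib by (simp only: add_diff_add)
qed

text \<open>The correction at \<open>f e\<close> carries the factor \<open>sum a F\<close>, so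
  zero-sum combinations are simply pushed forward, even if \<open>f\<close> moves the base
  point.\<close>

lemma is_lip_free_map_funpow_delta_sum:
  assumes "is_lip_free_map f e T" "finite F" "sum a F = 0"
  shows "(T ^^ n) (delta_sum e F a x) = delta_sum e F a (\<lambda>q. (f ^^ n) (x q))"
  by (induction n) (simp_all add: is_lip_free_map_delta_sum[OF assms(1,2)] assms(3))

section \<open>Detecting subset sums with plateau functions\<close>

text \<open>The function is 1 where the distance to \<open>p\<close> is at most
  \<open>(t - 1) * h\<close> and 0 where it is at least \<open>t * h\<close>.\<close>

lemma lipschitz_on_plateau:
  fixes p :: "'a::metric_space"
  assumes "0 < h"
  shows "(1 / h)-lipschitz_on UNIV
    (\<lambda>z. of_real (max 0 (min 1 (t - dist z p / h))) :: 'k::real_normed_field)"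
proof (rule lipschitz_onI)
  fix y z
  have "\<bar>max 0 (min 1 (t - dist y p / h)) - max 0 (min 1 (t - dist z p / h))\<bar>
      \<le> \<bar>dist y p / h - dist z p / h\<bar>" by auto
  also have "\<dots> = \<bar>dist y p - dist z p\<bar> / h" using assms by (simp flip: diff_divide_distrib)
  also have "\<dots> \<le> dist y z / h"
    using assms abs_dist_diff_le[of y p z] by (intro divide_right_mono) (auto simp: dist_commute)
  finally show "dist (of_real (max 0 (min 1 (t - dist y p / h))) :: 'k)
     (of_real (max 0 (min 1 (t - dist z p / h)))) \<le> 1 / h * dist y z"
    by (simp add: dist_norm flip: of_real_diff)
qed (use assms in auto)

text \<open>Testing against a function that is 1 near \<open>p\<close>, 0 at the other points of \<open>F\<close>, and whose
  transition zone is an annulus free of points \<open>x q\<close> (found by the pigeonhole principle) exhibits the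
  difference between \<open>a p\<close> and a subset sum of \<open>a\<close>.\<close>

lemma subset_sum_near_coefficient:
  fixes a :: "'a::metric_space \<Rightarrow> 'k::real_normed_field"
  assumes F: "finite F" "sum a F = 0" and p: "p \<in> F" and r: "0 < r"
    and sep: "\<And>q. q \<in> F \<Longrightarrow> q \<noteq> p \<Longrightarrow> r \<le> dist q p"
  shows "\<exists>S\<subseteq>{q \<in> F. dist (x q) p < r}. norm (sum a S - a p) * (r / (card F + 1))
    \<le> dual_norm e (delta_sum e F a x - delta_sum e F a (\<lambda>q. q))"
proof -
  \<comment> \<open>The ball of radius \<open>r\<close> about \<open>p\<close> splits into
    \<open>card F + 1\<close> annuli of width \<open>h\<close>. The at most \<open>card F\<close>
    points \<open>x q\<close> miss one of them, with index \<open>i\<close>.\<close>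
  define h where "h = r / (card F + 1)"
  have h: "0 < h" using r by (simp add: h_def)
  have "card ((\<lambda>q. nat \<lfloor>dist (x q) p / h\<rfloor>) ` F) < card {..card F}"
    using card_image_le[OF F(1)] by (simp add: less_Suc_eq_le)
  then have "\<not> {..card F} \<subseteq> (\<lambda>q. nat \<lfloor>dist (x q) p / h\<rfloor>) ` F"
    using F(1) card_mono[of "(\<lambda>q. nat \<lfloor>dist (x q) p / h\<rfloor>) ` F" "{..card F}"] by auto
  then obtain i where i: "i \<le> card F" "\<And>q. q \<in> F \<Longrightarrow> nat \<lfloor>dist (x q) p / h\<rfloor> \<noteq> i" by auto
  have zone: "dist (x q) p / h < i \<or> i + 1 \<le> dist (x q) p / h" if "q \<in> F" for q
  proof (rule ccontr)
    assume "\<not> (dist (x q) p / h < i \<or> i + 1 \<le> dist (x q) p / h)"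
    then have "\<lfloor>dist (x q) p / h\<rfloor> = int i" by (intro floor_unique) auto
    then show False using i(2)[OF that] by simp
  qed
  \<comment> \<open>The slope lies over the empty annulus, so \<phi> takes only the values 0 and 1
    at the points \<open>x q\<close>. Since \<open>i \<le> card F\<close>, the annulus ends within
    radius \<open>r\<close>, before any other point of \<open>F\<close>.\<close>
  define \<phi> :: "'a \<Rightarrow> 'k" where "\<phi> = (\<lambda>z. of_real (max 0 (min 1 (real (i + 1) - dist z p / h))))"
  define S where "S = {q \<in> F. dist (x q) p / h < i}"
  have ir: "real (i + 1) * h \<le> r"
  proof -
    have "real (i + 1) * h \<le> real (card F + 1) * h" using i(1) h by (intro mult_right_mono) auto
    then show ?thesis by (simp add: h_def)
  qed
  have "(\<Sum>q\<in>F. a q * \<phi> (x q)) = (\<Sum>q\<in>F. if q \<in> S then a q else 0)"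
    using zone by (intro sum.cong refl) (force simp: \<phi>_def S_def)
  also have "\<dots> = sum a S" using F(1) by (simp add: S_def sum.inter_filter)
  finally have 1: "(\<Sum>q\<in>F. a q * \<phi> (x q)) = sum a S" .
  have "\<phi> q = (if q = p then 1 else 0)" if "q \<in> F" for q
  proof (cases "q = p")
    case False
    then have "real (i + 1) * h \<le> dist q p" using sep[OF that] ir by linarith
    then have "real (i + 1) \<le> dist q p / h" using h by (simp add: field_simps)
    then show ?thesis using False by (simp add: \<phi>_def)
  qed (simp add: \<phi>_def)
  then have "(\<Sum>q\<in>F. a q * \<phi> q) = (\<Sum>q\<in>F. if q = p then a q else 0)"
    by (intro sum.cong refl) auto
  then have 2: "(\<Sum>q\<in>F. a q * \<phi> q) = a p" using F(1) p by simp
  have "norm (sum a S - a p) \<le> dual_norm e (delta_sum e F a x - delta_sum e F a (\<lambda>q. q)) * (1 / h)"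
    using dual_norm_delta_sum_diff_ge[OF F(2) lipschitz_on_plateau[OF h, of "real (i + 1)" p],
        where x=x and y="\<lambda>q. q" and e=e] 1 2 unfolding \<phi>_def by simp
  then have "norm (sum a S - a p) * h \<le> dual_norm e (delta_sum e F a x - delta_sum e F a (\<lambda>q. q))"
    using h by (simp add: field_simps)
  moreover have "S \<subseteq> {q \<in> F. dist (x q) p < r}"
  proof
    fix q assume "q \<in> S"
    then have "q \<in> F" "dist (x q) p < real i * h" using h by (auto simp: S_def field_simps)
    moreover have "real i * h \<le> r" using ir h by (simp add: algebra_simps)
    ultimately show "q \<in> {q \<in> F. dist (x q) p < r}" by auto
  qed
  ultimately show ?thesis unfolding h_def by blast
qed

section \<open>Coefficients avoiding all subset-sum relations\<close>

text \<open>The choice \<open>S = {}\<close> is included, so generic coefficients are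
  nonzero.\<close>

definition subset_sum_generic :: "'a set \<Rightarrow> ('a \<Rightarrow> 'k::comm_monoid_add) \<Rightarrow> bool" where
  "subset_sum_generic F a \<longleftrightarrow> (\<forall>p\<in>F. \<forall>S\<subseteq>F - {p}. sum a S \<noteq> a p)"

text \<open>Distinct powers of two are put at the points other than \<open>e\<close>, and their
  negative total at \<open>e\<close>. Signs settle the relations that involve \<open>e\<close>;
  uniqueness of binary expansions settles the others.\<close>

lemma subset_sum_generic_exists:
  assumes "finite F" "e \<in> F" "F \<noteq> {e}"
  obtains c :: "'a \<Rightarrow> real" where "sum c F = 0" "subset_sum_generic F c"
proof -
  obtain g :: "'a \<Rightarrow> nat" where g: "inj_on g F"
    using finite_imp_inj_to_nat_seg[OF assms(1)] by blast
  define G where "G = F - {e}"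
  define c :: "'a \<Rightarrow> real" where "c = (\<lambda>q. if q = e then - (\<Sum>q\<in>G. 2 ^ g q) else 2 ^ g q)"
  have G: "finite G" "G \<noteq> {}" "e \<notin> G" "F = insert e G" using assms by (auto simp: G_def)
  have cpos: "0 < c q" if "q \<in> G" for q using that G by (auto simp: c_def)
  have ce: "c e = - sum c G"
  proof -
    have "sum c G = (\<Sum>q\<in>G. 2 ^ g q)" using G by (intro sum.cong) (auto simp: c_def)
    then show ?thesis by (simp add: c_def)
  qed
  have sc: "sum c F = 0" using G ce by simp
  have "sum c S \<noteq> c p" if p: "p \<in> F" and S: "S \<subseteq> F - {p}" for p S
  proof
    assume eq: "sum c S = c p"
    have finS: "finite S" using S assms(1) by (auto intro: finite_subset)
    consider "p = e" | "p \<in> G" "e \<in> S" | "p \<in> G" "e \<notin> S" using p G by auto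
    then show False
    proof cases
      case 1
      then have "0 \<le> sum c S" using S G cpos by (intro sum_nonneg) (auto intro: less_imp_le)
      moreover have "0 < sum c G" using G cpos by (intro sum_pos) auto
      ultimately show False using eq 1 ce by simp
    next
      case 2
      \<comment> \<open>With \<open>e\<close> in \<open>S\<close>, the complement of
        \<open>S\<close> has nonnegative sum, so \<open>sum c S\<close> is at most 0, whereas
        \<open>c p\<close> is positive.\<close>
      have "sum c F = sum c S + sum c (F - S)"
        using S assms(1) by (metis Diff_subset add.commute subset_trans sum.subset_diff)
      moreover have "0 \<le> sum c (F - S)" 
        using 2 G cpos by (intro sum_nonneg) (auto intro: less_imp_le)
      ultimately show False using sc eq cpos[OF 2(1)] by simp
    next
      case 3
      have "inj_on g S" using S g by (auto intro: inj_on_subset)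
      have "real (set_encode (g ` S)) = real (set_encode {g p})"
      proof -
        have "real (set_encode (g ` S)) = (\<Sum>q\<in>S. 2 ^ g q)"
          using \<open>inj_on g S\<close> by (simp add: set_encode_def sum.reindex)
        also have "\<dots> = sum c S" using 3 by (intro sum.cong) (auto simp: c_def)
        also have "\<dots> = 2 ^ g p" using 3 G eq by (auto simp: c_def)
        finally show ?thesis by (simp add: set_encode_def)
      qed
      then have "g ` S = {g p}" using finS set_encode_eq[of "g ` S" "{g p}"] by simp
      then obtain q where "q \<in> S" "g q = g p" by (metis imageE insertI1)
      then show False using S p g by (auto dest: inj_onD)
    qed
  qed
  with sc show thesis using that unfolding subset_sum_generic_def by blast
qed

text \<open>Each of the finitely many forbidden equations excludes at most one parameter \<open>t\<close>.\<close>

lemma subset_sum_generic_perturbation: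
  fixes b :: "'a \<Rightarrow> 'k::real_normed_field"
  assumes F: "finite F" and \<eta>: "0 < (\<eta>::real)"
    and c: "subset_sum_generic F (c :: 'a \<Rightarrow> real)"
  obtains t where "0 < t" "t < \<eta>" "subset_sum_generic F (\<lambda>q. b q + of_real (t * c q))"
proof -
  define B where "B = (\<lambda>(p, S). {t. (\<Sum>q\<in>S. b q + of_real (t * c q)) = b p + of_real (t * c p)})"
  have "finite (B (p, S))" if p: "p \<in> F" "S \<subseteq> F - {p}" for p S
  proof -
    \<comment> \<open>The forbidden relation is affine in \<open>t\<close>, with slope
      \<open>sum c S - c p\<close>, which is nonzero by genericity of \<open>c\<close>.\<close>
    have "s = t" if "s \<in> B (p, S)" "t \<in> B (p, S)" for s t
    proof -
      have 1: "of_real (t * c p - t * sum c S) = sum b S - b p" if "t \<in> B (p, S)" for t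
        using that by (simp add: B_def sum.distrib sum_distrib_left algebra_simps)
      have "(of_real (s * c p - s * sum c S) :: 'k) = of_real (t * c p - t * sum c S)"
        using 1[OF that(1)] 1[OF that(2)] by simp
      then have "s * c p - s * sum c S = t * c p - t * sum c S" by (simp only: of_real_eq_iff)
      then have "(s - t) * (sum c S - c p) = 0" by (simp add: algebra_simps)
      then show ?thesis using c p by (auto simp: subset_sum_generic_def)
    qed
    then have "B (p, S) \<subseteq> {SOME t. t \<in> B (p, S)}" by (metis insertI1 someI subsetI)
    then show ?thesis by (rule finite_subset) simp
  qed
  then have "finite (\<Union>(B ` (SIGMA p:F. Pow (F - {p}))))"
    using F by (intro finite_UN_I finite_SigmaI) auto
  then have "infinite ({0<..<\<eta>} - \<Union>(B ` (SIGMA p:F. Pow (F - {p}))))"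
    using \<eta> by (intro Diff_infinite_finite) (auto simp: infinite_Ioo)
  then obtain t where "t \<in> {0<..<\<eta>} - \<Union>(B ` (SIGMA p:F. Pow (F - {p})))"
    by (metis finite.emptyI ex_in_conv)
  then show thesis using that[of t] by (fastforce simp: B_def subset_sum_generic_def)
qed

section \<open>From recurrent vectors to jointly recurrent points\<close>

lemma recurrent_set_frequently:
  assumes "u \<in> recurrent_set X N T" "0 < \<epsilon>"
  shows "\<exists>\<^sub>F n in sequentially. N ((T ^^ n) u - u) < \<epsilon>"
proof (rule ccontr)
  assume "\<not> ?thesis"
  then have "\<forall>\<^sub>F n in sequentially. ereal \<epsilon> \<le> ereal (N ((T ^^ n) u - u))"
    by (simp add: not_frequently not_less)
  then have "ereal \<epsilon> \<le> liminf (\<lambda>n. ereal (N ((T ^^ n) u - u)))" by (rule Liminf_bounded)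
  then show False using assms by (simp add: recurrent_set_def)
qed

text \<open>By density, the span meets a small ball about any interior point, and half the radius
  still fits around the element found.\<close>

lemma lip_free_interior_meets_span:
  fixes S :: "(('a::metric_space \<Rightarrow> 'k::real_normed_field) \<Rightarrow> 'k) set"
  assumes "Metric_space.mtopology (lip_free e) (\<lambda>x y. dual_norm e (x - y)) interior_of S \<noteq> {}"
  obtains w \<rho> where "w \<in> pointwise.span (range (delta e))" "0 < \<rho>"
    "\<And>v. v \<in> lip_free e \<Longrightarrow> dual_norm e (w - v) < \<rho> \<Longrightarrow> v \<in> S"
proof -
  interpret Metric_space "lip_free e" "\<lambda>x y :: ('a \<Rightarrow> 'k) \<Rightarrow> 'k. dual_norm e (x - y)"
    by (rule Metric_space_lip_free)
  from assms obtain u where u: "u \<in> mtopology interior_of S" by blast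
  then obtain \<rho> where \<rho>: "0 < \<rho>" "mball u \<rho> \<subseteq> mtopology interior_of S"
    using openin_interior_of[of mtopology S] unfolding openin_mtopology by blast
  have uF: "u \<in> lip_free e"
    using u interior_of_subset_topspace[of mtopology S] by auto
  then obtain w where w: "w \<in> pointwise.span (range (delta e))" "dual_norm e (u - w) < \<rho> / 2"
    using \<rho>(1) unfolding lip_free_iff by (meson half_gt_zero)
  have "v \<in> S" if "v \<in> lip_free e" "dual_norm e (w - v) < \<rho> / 2" for v
  proof -
    have "dual_norm e (u - v) < \<rho>"
      using triangle[OF uF span_lip_free[OF w(1)] that(1)] w(2) that(2) by linarith
    then show ?thesis using \<rho>(2) uF that(1) interior_of_subset[of mtopology S] by auto
  qed
  then show thesis using that[OF w(1), of "\<rho> / 2"] \<rho>(1) by simp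
qed

text \<open>A sufficiently close return of the vector makes some subset sum nearly equal to
  \<open>a p\<close>. Genericity forces the subset to contain \<open>p\<close>, and its members have
  all been moved near \<open>p\<close>. The same \<open>n\<close> works for every
  \<open>p\<close>.\<close>

lemma frequently_near_of_generic_recurrent:
  fixes a :: "'a::metric_space \<Rightarrow> 'k::real_normed_field"
  assumes T: "is_lip_free_map f e T" and F: "finite F" "sum a F = 0"
    and gen: "subset_sum_generic F a"
    and rec: "delta_sum e F a (\<lambda>q. q) \<in> recurrent_set X (dual_norm e) T"
    and r: "0 < r"
  shows "\<exists>\<^sub>F n in sequentially. \<forall>p\<in>F. dist ((f ^^ n) p) p < r"
proof -
  \<comment> \<open>Inserting \<open>r\<close> keeps the minimum defined and at most
    \<open>r\<close>; inserting 1 into \<open>E\<close> below likewise covers an empty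
    \<open>F\<close>.\<close>
  define D where "D = insert r ((\<lambda>(p, q). dist q p) ` {(p, q) \<in> F \<times> F. p \<noteq> q})"
  have D: "finite D" "D \<noteq> {}"
    unfolding D_def using F(1) by (auto intro!: finite_imageI intro: finite_subset[of _ "F \<times> F"])
  define s where "s = Min D"
  have s: "0 < s" "s \<le> r" "\<And>p q. p \<in> F \<Longrightarrow> q \<in> F \<Longrightarrow> q \<noteq> p \<Longrightarrow> s \<le> dist q p"
    unfolding s_def using D r by (auto simp: D_def intro!: Min_le)
  define E where "E = insert 1 ((\<lambda>(p, S). norm (sum a S - a p)) ` (SIGMA p:F. Pow (F - {p})))"
  have E: "finite E" "E \<noteq> {}" using F(1) by (auto simp: E_def)
  define \<gamma> where "\<gamma> = Min E"
  have \<gamma>: "0 < \<gamma>" "\<And>p S. p \<in> F \<Longrightarrow> S \<subseteq> F - {p} \<Longrightarrow> \<gamma> \<le> norm (sum a S - a p)"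
    unfolding \<gamma>_def using E gen by (force simp: E_def subset_sum_generic_def intro!: Min_le)+
  have "0 < \<gamma> * (s / (card F + 1))" using \<gamma> s by simp
  from recurrent_set_frequently[OF rec this] show ?thesis
  proof (rule frequently_elim1, intro ballI)
    fix n p
    assume n: "dual_norm e ((T ^^ n) (delta_sum e F a (\<lambda>q. q)) - delta_sum e F a (\<lambda>q. q))
        < \<gamma> * (s / (card F + 1))" and p: "p \<in> F"
    obtain S where S: "S \<subseteq> {q \<in> F. dist ((f ^^ n) q) p < s}"
      "norm (sum a S - a p) * (s / (card F + 1))
        \<le> dual_norm e (delta_sum e F a (f ^^ n) - delta_sum e F a (\<lambda>q. q))"
      using subset_sum_near_coefficient[OF F p s(1), of "f ^^ n" e] s(3)[OF p] by blast
    have "norm (sum a S - a p) * (s / (card F + 1)) < \<gamma> * (s / (card F + 1))"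
      using S(2) n is_lip_free_map_funpow_delta_sum[OF T F, of n "\<lambda>q. q"] by simp
    then have "norm (sum a S - a p) < \<gamma>"
      using s(1) by (simp add: mult_less_cancel_right divide_less_cancel)
    then have "\<not> S \<subseteq> F - {p}" using \<gamma>(2)[OF p, of S] by auto
    then show "dist ((f ^^ n) p) p < r" using S(1) s(2) by auto
  qed
qed

section \<open>Incompatibility of the two interiors\<close>

lemma not_wild_lip_free_map:
  fixes T :: "(('a::metric_space \<Rightarrow> 'k::real_normed_field) \<Rightarrow> 'k) \<Rightarrow> (('a \<Rightarrow> 'k) \<Rightarrow> 'k)"
  assumes T: "is_lip_free_map f e T"
  shows "\<not> wild (lip_free e) (dual_norm e) T"
proof
  assume W: "wild (lip_free e) (dual_norm e) T"
  obtain w \<rho> where w: "w \<in> pointwise.span (range (delta e))" and \<rho>: "0 < \<rho>"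
    and wR: "\<And>v. v \<in> lip_free e \<Longrightarrow> dual_norm e (w - v) < \<rho>
      \<Longrightarrow> v \<in> recurrent_set (lip_free e) (dual_norm e) T"
    using W lip_free_interior_meets_span unfolding wild_def by metis
  obtain v \<sigma> where v: "v \<in> pointwise.span (range (delta e))" and \<sigma>: "0 < \<sigma>"
    and vA': "\<And>u. u \<in> lip_free e \<Longrightarrow> dual_norm e (v - u) < \<sigma>
      \<Longrightarrow> u \<in> escaping_set (lip_free e) (dual_norm e) T"
    using W lip_free_interior_meets_span unfolding wild_def by metis
  have vA: "v \<in> escaping_set (lip_free e) (dual_norm e) T"
    using vA'[OF span_lip_free[OF v]] \<sigma> by simp
  obtain Fw b where Fw: "finite Fw" "e \<in> Fw" "\<And>q. q \<notin> Fw \<Longrightarrow> b q = 0" "sum b Fw = 0"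
    and w_eq: "w = delta_sum e Fw b (\<lambda>q. q)" using span_delta_cases[OF w] by metis
  obtain Fv a where Fv: "finite Fv" "e \<in> Fv" "\<And>q. q \<notin> Fv \<Longrightarrow> a q = 0" "sum a Fv = 0"
    and v_eq: "v = delta_sum e Fv a (\<lambda>q. q)" using span_delta_cases[OF v] by metis
  define F where "F = Fw \<union> Fv"
  have F: "finite F" "e \<in> F" using Fw Fv by (auto simp: F_def)
  have sb: "sum b F = 0"
    using Fw F sum.mono_neutral_left[of F Fw b] by (auto simp: F_def)
  have freq: "\<exists>\<^sub>F n in sequentially. \<forall>p\<in>F. dist ((f ^^ n) p) p < r" if r: "0 < r" for r
  \<comment> \<open>No generic zero-sum coefficients exist on a single point. In that case
    \<open>v = 0\<close>, contradicting that \<open>v\<close> escapes.\<close>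
  proof (cases "F = {e}")
    case True
    then have "Fv = {e}" using Fv(2) by (auto simp: F_def)
    then have "a e = 0" using Fv(4) by simp
    have "(T ^^ n) v = 0" for n
      using is_lip_free_map_funpow_delta_sum[OF T Fv(1,4), of n "\<lambda>q. q"] \<open>Fv = {e}\<close> \<open>a e = 0\<close>
      by (simp add: v_eq delta_sum_def)
    then have "filterlim (\<lambda>n::nat. 0::real) at_top sequentially"
      using vA by (simp add: escaping_set_def)
    then have "\<forall>\<^sub>F n::nat in sequentially. (1::real) \<le> 0" unfolding filterlim_at_top by blast
    then show ?thesis by simp
  next
    case False
    obtain c :: "'a \<Rightarrow> real" where c: "sum c F = 0" "subset_sum_generic F c"
      using subset_sum_generic_exists[OF F False] by metis
    \<comment> \<open>Moving every point to \<open>e\<close> turns a combination into 0, so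
      \<open>t * K\<close> bounds the dual norm of the perturbation with coefficients
      \<open>t * c q\<close>.\<close>
    define K where "K = (\<Sum>q\<in>F. \<bar>c q\<bar> * dist q e)"
    have K: "0 \<le> K" by (auto simp: K_def intro: sum_nonneg)
    then have "0 < \<rho> / (K + 1)" using \<rho> by simp
    then obtain t where t: "0 < t" "t < \<rho> / (K + 1)"
      and gen: "subset_sum_generic F (\<lambda>q. b q + of_real (t * c q))"
      using subset_sum_generic_perturbation[OF F(1) _ c(2)] by metis
    define d where "d = (\<lambda>q. b q + of_real (t * c q))"
    have "(\<Sum>q\<in>F. of_real (t * c q) :: 'k) = of_real (t * sum c F)"
      by (simp only: sum_distrib_left of_real_sum)
    then have sd: "sum d F = 0" using sb c(1) by (simp add: d_def sum.distrib)
    have "w - delta_sum e F d (\<lambda>q. q) = delta_sum e F (\<lambda>q. of_real (t * c q)) (\<lambda>_. e)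
       - delta_sum e F (\<lambda>q. of_real (t * c q)) (\<lambda>q. q)"
      using delta_sum_mono_neutral[of F Fw b e "\<lambda>q. q"] F Fw
      by (simp add: w_eq delta_sum_def F_def d_def pointwise.scale_left_distrib sum.distrib)
    then have "dual_norm e (w - delta_sum e F d (\<lambda>q. q))
        \<le> (\<Sum>q\<in>F. norm (of_real (t * c q) :: 'k) * dist e q)"
      by (simp only: dual_norm_delta_sum_diff_le)
    also have "\<dots> = t * K"
      using t(1) by (simp add: K_def sum_distrib_left norm_mult dist_commute mult.assoc)
    also have "\<dots> \<le> t * (K + 1)" using t(1) by simp
    also have "\<dots> < \<rho>" using t(2) K by (simp add: pos_less_divide_eq)
    finally have "delta_sum e F d (\<lambda>q. q) \<in> recurrent_set (lip_free e) (dual_norm e) T"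
      by (intro wR span_lip_free delta_sum_span)
    then show ?thesis
      using gen by (intro frequently_near_of_generic_recurrent[OF T F(1) sd _ _ r])
        (simp_all add: d_def)
  qed
  \<comment> \<open>When each point of \<open>F\<close> returns within \<open>1 / (A + 1)\<close>,
    the iterate of \<open>v\<close> returns within 1. This happens for infinitely many
    \<open>n\<close>, so the orbit norms cannot tend to infinity.\<close>
  define A where "A = (\<Sum>q\<in>Fv. norm (a q))"
  have A: "0 \<le> A" by (auto simp: A_def intro: sum_nonneg)
  have "\<exists>\<^sub>F n in sequentially. dual_norm e ((T ^^ n) v) \<le> 1 + dual_norm e v"
    using freq[of "1 / (A + 1)"]
  proof (rule frequently_elim1)
    show "0 < 1 / (A + 1)" using A by simp
    fix n assume n: "\<forall>p\<in>F. dist ((f ^^ n) p) p < 1 / (A + 1)"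
    have eq: "(T ^^ n) v = delta_sum e Fv a (f ^^ n)"
      using is_lip_free_map_funpow_delta_sum[OF T Fv(1,4), of n "\<lambda>q. q"] by (simp add: v_eq)
    have "dual_norm e (delta_sum e Fv a (f ^^ n) - delta_sum e Fv a (\<lambda>q. q))
        \<le> (\<Sum>q\<in>Fv. norm (a q) * dist ((f ^^ n) q) q)" by (rule dual_norm_delta_sum_diff_le)
    also have "\<dots> \<le> (\<Sum>q\<in>Fv. norm (a q) * (1 / (A + 1)))"
      using n by (intro sum_mono mult_left_mono) (auto simp: F_def less_imp_le)
    also have "\<dots> = A * (1 / (A + 1))" by (simp only: A_def sum_distrib_right)
    also have "\<dots> \<le> 1" using A by simp
    finally have "dual_norm e ((T ^^ n) v - v) \<le> 1" unfolding eq by (simp add: v_eq)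
    moreover have "(T ^^ n) v \<in> lip0_dual e" "v \<in> lip0_dual e"
      using delta_sum_dual[of e Fv a] lip_free_dual[OF span_lip_free[OF v]] by (simp_all only: eq)
    then have "dual_norm e (((T ^^ n) v - v) + v) \<le> dual_norm e ((T ^^ n) v - v) + dual_norm e v"
      by (intro dual_norm_triangle dual_diff)
    ultimately show "dual_norm e ((T ^^ n) v) \<le> 1 + dual_norm e v" by simp
  qed
  moreover have "\<forall>\<^sub>F n in sequentially. 1 + dual_norm e v < dual_norm e ((T ^^ n) v)"
    using vA by (auto simp: escaping_set_def filterlim_at_top_dense)
  ultimately show False by (simp add: frequently_def not_le)
qed

theorem proposition5p11:
  fixes f :: "'a::metric_space \<Rightarrow> 'a" and e :: 'a
  assumes "\<exists>L. L-lipschitz_on UNIV f"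
  shows "\<not> wild (lip_free e :: (('a \<Rightarrow> real) \<Rightarrow> real) set) (dual_norm e) (lip_free_map f e) \<and>
         \<not> wild (lip_free e :: (('a \<Rightarrow> complex) \<Rightarrow> complex) set) (dual_norm e) (lip_free_map f e)"
proof -
  obtain L where "L-lipschitz_on UNIV f" using assms by blast
  then show ?thesis
    by (intro conjI not_wild_lip_free_map[of f] is_lip_free_map_lip_free_map)
qed

end
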